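(* Let $X$ be a Tychonoff space. Then the following assertions are equivalent: (i) $B_1(X)$ is sequentially complete; (ii) $B_1(X)$ is locally complete; (iii) $B_1(X)=B_2(X)$; (iv) $X$ is a $CZ$-space.
   Context: All topological spaces are Tychonoff. $C(X)$ is the set of continuous real-valued functions on $X$. $B_1(X)$ is the space of all functions $f:X\to\mathbb{R}$ that are pointwise limits of sequences from $C(X)$ (Baire-one functions), and $B_2(X)$ is the space of all functions $f:X\to\mathbb{R}$ that are pointwise limits of sequences from $B_1(X)$. These are real locally convex spaces with the pointwise topology (subspace topology from $\mathbb{R}^X$). A subset $A\subseteq X$ is a zero-set if $A=f^{-1}(0)$ for some $f\in C(X)$; a cozero-set is the complement of a zero-set. A $Zer_\sigma$-set is a countable union of zero-sets, and a $Coz_\delta$-set is a countable intersection of cozero-sets. $X$ is a $CZ$-space if every $Zer_\sigma$-set of $X$ is a $Coz_\delta$-set. A Hausdorff locally convex space $E$ is sequentially complete if each Cauchy sequence in $E$ converges, and locally complete if the closed absolutely convex hull of every null sequence (sequence converging to $0$) in $E$ is compact. *)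

theory Defs
  imports "HOL-Analysis.Analysis"
begin

section \<open>Hausdorff real locally convex spaces\<close>

text \<open>The carrier of a space is the topspace of its topology.\<close>

record 'v lcs =
  lcs_top :: "'v topology"
  lcs_zero :: 'v
  lcs_add :: "'v \<Rightarrow> 'v \<Rightarrow> 'v"
  lcs_scale :: "real \<Rightarrow> 'v \<Rightarrow> 'v"

abbreviation lcs_carrier :: "('v, 'm) lcs_scheme \<Rightarrow> 'v set"
  where "lcs_carrier E \<equiv> topspace (lcs_top E)"

definition lcs_diff :: "('v, 'm) lcs_scheme \<Rightarrow> 'v \<Rightarrow> 'v \<Rightarrow> 'v"
  where "lcs_diff E u v = lcs_add E u (lcs_scale E (-1) v)"

definition lcs_convex :: "('v, 'm) lcs_scheme \<Rightarrow> 'v set \<Rightarrow> bool"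
  where "lcs_convex E A \<longleftrightarrow> A \<subseteq> lcs_carrier E \<and>
    (\<forall>u\<in>A. \<forall>v\<in>A. \<forall>a b. 0 \<le> a \<and> 0 \<le> b \<and> a + b = 1 \<longrightarrow>
       lcs_add E (lcs_scale E a u) (lcs_scale E b v) \<in> A)"

definition lcs_balanced :: "('v, 'm) lcs_scheme \<Rightarrow> 'v set \<Rightarrow> bool"
  where "lcs_balanced E A \<longleftrightarrow> A \<subseteq> lcs_carrier E \<and>
    (\<forall>u\<in>A. \<forall>c. \<bar>c\<bar> \<le> 1 \<longrightarrow> lcs_scale E c u \<in> A)"

definition absolutely_convex :: "('v, 'm) lcs_scheme \<Rightarrow> 'v set \<Rightarrow> bool"
  where "absolutely_convex E A \<longleftrightarrow> lcs_convex E A \<and> lcs_balanced E A"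

locale hausdorff_lcs =
  fixes E :: "('v, 'm) lcs_scheme"
  assumes zero_closed: "lcs_zero E \<in> lcs_carrier E"
    and add_closed: "\<lbrakk>u \<in> lcs_carrier E; v \<in> lcs_carrier E\<rbrakk> \<Longrightarrow> lcs_add E u v \<in> lcs_carrier E"
    and scale_closed: "u \<in> lcs_carrier E \<Longrightarrow> lcs_scale E c u \<in> lcs_carrier E"
    and add_assoc: "\<lbrakk>u \<in> lcs_carrier E; v \<in> lcs_carrier E; w \<in> lcs_carrier E\<rbrakk>
      \<Longrightarrow> lcs_add E (lcs_add E u v) w = lcs_add E u (lcs_add E v w)"
    and add_commute: "\<lbrakk>u \<in> lcs_carrier E; v \<in> lcs_carrier E\<rbrakk> \<Longrightarrow> lcs_add E u v = lcs_add E v u"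
    and add_zero: "u \<in> lcs_carrier E \<Longrightarrow> lcs_add E (lcs_zero E) u = u"
    and diff_self: "u \<in> lcs_carrier E \<Longrightarrow> lcs_diff E u u = lcs_zero E"
    and scale_one: "u \<in> lcs_carrier E \<Longrightarrow> lcs_scale E 1 u = u"
    and scale_scale: "u \<in> lcs_carrier E \<Longrightarrow> lcs_scale E a (lcs_scale E b u) = lcs_scale E (a * b) u"
    and scale_add_left: "u \<in> lcs_carrier E
      \<Longrightarrow> lcs_scale E (a + b) u = lcs_add E (lcs_scale E a u) (lcs_scale E b u)"
    and scale_add_right: "\<lbrakk>u \<in> lcs_carrier E; v \<in> lcs_carrier E\<rbrakk>
      \<Longrightarrow> lcs_scale E a (lcs_add E u v) = lcs_add E (lcs_scale E a u) (lcs_scale E a v)"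
    and hausdorff: "Hausdorff_space (lcs_top E)"
    and continuous_add: "continuous_map (prod_topology (lcs_top E) (lcs_top E)) (lcs_top E)
      (\<lambda>(u, v). lcs_add E u v)"
    and continuous_scale: "continuous_map (prod_topology euclideanreal (lcs_top E)) (lcs_top E)
      (\<lambda>(c, u). lcs_scale E c u)"
    and locally_convex: "\<lbrakk>openin (lcs_top E) U; lcs_zero E \<in> U\<rbrakk>
      \<Longrightarrow> \<exists>V. openin (lcs_top E) V \<and> lcs_convex E V \<and> lcs_zero E \<in> V \<and> V \<subseteq> U"

definition lcs_Cauchy :: "('v, 'm) lcs_scheme \<Rightarrow> (nat \<Rightarrow> 'v) \<Rightarrow> bool"
  where "lcs_Cauchy E \<sigma> \<longleftrightarrow> range \<sigma> \<subseteq> lcs_carrier E \<and>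
    (\<forall>U. openin (lcs_top E) U \<and> lcs_zero E \<in> U \<longrightarrow>
       (\<exists>N. \<forall>m\<ge>N. \<forall>n\<ge>N. lcs_diff E (\<sigma> m) (\<sigma> n) \<in> U))"

definition sequentially_complete :: "('v, 'm) lcs_scheme \<Rightarrow> bool"
  where "sequentially_complete E \<longleftrightarrow>
    (\<forall>\<sigma>. lcs_Cauchy E \<sigma> \<longrightarrow> (\<exists>l. limitin (lcs_top E) \<sigma> l sequentially))"

definition null_sequence :: "('v, 'm) lcs_scheme \<Rightarrow> (nat \<Rightarrow> 'v) \<Rightarrow> bool"
  where "null_sequence E \<sigma> \<longleftrightarrow> range \<sigma> \<subseteq> lcs_carrier E \<and>
    limitin (lcs_top E) \<sigma> (lcs_zero E) sequentially"

text \<open>The smallest absolutely convex subset containing \<open>S\<close> that is closed in \<open>E\<close> itself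
  (not in a larger ambient space).\<close>

definition closed_absolutely_convex_hull :: "('v, 'm) lcs_scheme \<Rightarrow> 'v set \<Rightarrow> 'v set"
  where "closed_absolutely_convex_hull E S =
    (\<lambda>A. closedin (lcs_top E) A \<and> absolutely_convex E A) hull S"

definition locally_complete :: "('v, 'm) lcs_scheme \<Rightarrow> bool"
  where "locally_complete E \<longleftrightarrow>
    (\<forall>\<sigma>. null_sequence E \<sigma> \<longrightarrow>
       compactin (lcs_top E) (closed_absolutely_convex_hull E (range \<sigma>)))"


section \<open>Baire classes of real functions\<close>

text \<open>A function on \<open>topspace X\<close> is represented by its extensional extension, so that equality of
  sets of functions is equality of sets of functions on \<open>topspace X\<close>, and so that these sets
  are subsets of the product \<open>powertop_real (topspace X)\<close>.\<close>

definition C_fun :: "'a topology \<Rightarrow> ('a \<Rightarrow> real) set"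
  where "C_fun X = {f \<in> extensional (topspace X). continuous_map X euclideanreal f}"

definition pointwise_seq_limits :: "'a set \<Rightarrow> ('a \<Rightarrow> real) set \<Rightarrow> ('a \<Rightarrow> real) set"
  where "pointwise_seq_limits S F = {f \<in> extensional S.
    \<exists>g :: nat \<Rightarrow> 'a \<Rightarrow> real. (\<forall>n. g n \<in> F) \<and> (\<forall>x\<in>S. (\<lambda>n. g n x) \<longlonglongrightarrow> f x)}"

definition B1_fun :: "'a topology \<Rightarrow> ('a \<Rightarrow> real) set"
  where "B1_fun X = pointwise_seq_limits (topspace X) (C_fun X)"

definition B2_fun :: "'a topology \<Rightarrow> ('a \<Rightarrow> real) set"
  where "B2_fun X = pointwise_seq_limits (topspace X) (B1_fun X)"

definition pointwise_lcs :: "'a set \<Rightarrow> ('a \<Rightarrow> real) set \<Rightarrow> ('a \<Rightarrow> real) lcs"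
  where "pointwise_lcs S F =
    \<lparr>lcs_top = subtopology (powertop_real S) F,
     lcs_zero = (\<lambda>x\<in>S. 0),
     lcs_add = (\<lambda>f g. \<lambda>x\<in>S. f x + g x),
     lcs_scale = (\<lambda>c f. \<lambda>x\<in>S. c * f x)\<rparr>"

definition B1_lcs :: "'a topology \<Rightarrow> ('a \<Rightarrow> real) lcs"
  where "B1_lcs X = pointwise_lcs (topspace X) (B1_fun X)"


section \<open>Zero-sets and CZ-spaces\<close>

definition zero_set :: "'a topology \<Rightarrow> 'a set \<Rightarrow> bool"
  where "zero_set X A \<longleftrightarrow> (\<exists>f. continuous_map X euclideanreal f \<and> A = {x \<in> topspace X. f x = 0})"

definition cozero_set :: "'a topology \<Rightarrow> 'a set \<Rightarrow> bool"
  where "cozero_set X A \<longleftrightarrow> (\<exists>Z. zero_set X Z \<and> A = topspace X - Z)"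

definition zer_sigma :: "'a topology \<Rightarrow> 'a set \<Rightarrow> bool"
  where "zer_sigma X = countable union_of zero_set X"

text \<open>As in the library definition of \<open>gdelta_in\<close>, the relativisation makes the intersection of
  the empty family \<open>topspace X\<close> rather than \<open>UNIV\<close>.\<close>

definition coz_delta :: "'a topology \<Rightarrow> 'a set \<Rightarrow> bool"
  where "coz_delta X = (countable intersection_of cozero_set X) relative_to topspace X"

definition CZ_space :: "'a topology \<Rightarrow> bool"
  where "CZ_space X \<longleftrightarrow> (\<forall>A. zer_sigma X A \<longrightarrow> coz_delta X A)"


section \<open>The function spaces are Hausdorff locally convex spaces\<close>

lemma pointwise_lcs_simps [simp]:
  "lcs_top (pointwise_lcs S F) = subtopology (powertop_real S) F"
  "lcs_zero (pointwise_lcs S F) = (\<lambda>x\<in>S. 0)"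
  "lcs_add (pointwise_lcs S F) = (\<lambda>f g. \<lambda>x\<in>S. f x + g x)"
  "lcs_scale (pointwise_lcs S F) = (\<lambda>c f. \<lambda>x\<in>S. c * f x)"
  by (simp_all add: pointwise_lcs_def)

definition function_subspace :: "'a set \<Rightarrow> ('a \<Rightarrow> real) set \<Rightarrow> bool"
  where "function_subspace S F \<longleftrightarrow> F \<subseteq> extensional S \<and> (\<lambda>x\<in>S. 0) \<in> F \<and>
    (\<forall>f\<in>F. \<forall>g\<in>F. (\<lambda>x\<in>S. f x + g x) \<in> F) \<and> (\<forall>c. \<forall>f\<in>F. (\<lambda>x\<in>S. c * f x) \<in> F)"

lemma carrier_pointwise_lcs:
  assumes "F \<subseteq> extensional S"
  shows "lcs_carrier (pointwise_lcs S F) = F"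
  using assms by (auto simp: PiE_def)

lemma hausdorff_lcs_pointwise:
  assumes F: "function_subspace S F"
  shows "hausdorff_lcs (pointwise_lcs S F)"
proof -
  let ?E = "pointwise_lcs S F"
  have ext: "F \<subseteq> extensional S" using F by (simp add: function_subspace_def)
  have car: "topspace (subtopology (powertop_real S) F) = F"
    using carrier_pointwise_lcs[OF ext] by simp
  have inter: "(S \<rightarrow>\<^sub>E UNIV) \<inter> F = F"
    using car by simp
  have sub: "(\<lambda>x\<in>S. 0) \<in> F" "\<And>f g. f \<in> F \<Longrightarrow> g \<in> F \<Longrightarrow> (\<lambda>x\<in>S. f x + g x) \<in> F"
    "\<And>c f. f \<in> F \<Longrightarrow> (\<lambda>x\<in>S. c * f x) \<in> F"
    using F by (auto simp: function_subspace_def)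
  have proj: "continuous_map (subtopology (powertop_real S) F) euclideanreal (\<lambda>f. f k)"
    if "k \<in> S" for k
    using that by (intro continuous_map_from_subtopology continuous_map_product_projection)
  have ext': "u \<in> extensional S" if "u \<in> F" for u
    using that ext by blast
  have eqI: "f = g" if "f \<in> extensional S" "g \<in> extensional S" "\<And>x. x \<in> S \<Longrightarrow> f x = g x"
    for f g :: "'a \<Rightarrow> real"
    using that by (rule extensionalityI)
  show ?thesis
  proof
    show "Hausdorff_space (lcs_top ?E)"
      by (simp add: Hausdorff_space_subtopology Hausdorff_space_product_topology)
    let ?T = "subtopology (powertop_real S) F"
    have 1: "continuous_map (prod_topology ?T ?T) euclideanreal (\<lambda>z. fst z k + snd z k)"
      if "k \<in> S" for k
      using continuous_map_compose[OF continuous_map_fst proj[OF that], of ?T]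
        continuous_map_compose[OF continuous_map_snd proj[OF that], of ?T]
      by (intro continuous_map_add) (auto simp: o_def)
    show "continuous_map (prod_topology (lcs_top ?E) (lcs_top ?E)) (lcs_top ?E)
      (\<lambda>(u, v). lcs_add ?E u v)"
      unfolding pointwise_lcs_simps case_prod_unfold
      apply (rule continuous_map_into_subtopology)
      subgoal using 1 by (auto simp: continuous_map_componentwise)
      subgoal using sub inter by (auto simp: car)
      done
    have 2: "continuous_map (prod_topology euclideanreal ?T) euclideanreal (\<lambda>z. fst z * snd z k)"
      if "k \<in> S" for k
      using continuous_map_compose[OF continuous_map_snd proj[OF that], of euclideanreal]
      by (intro continuous_map_real_mult continuous_map_fst) (auto simp: o_def)
    show "continuous_map (prod_topology euclideanreal (lcs_top ?E)) (lcs_top ?E)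
      (\<lambda>(c, u). lcs_scale ?E c u)"
      unfolding pointwise_lcs_simps case_prod_unfold
      apply (rule continuous_map_into_subtopology)
      subgoal using 2 by (auto simp: continuous_map_componentwise)
      subgoal using sub inter by (auto simp: car)
      done
    show "\<exists>V. openin (lcs_top ?E) V \<and> lcs_convex ?E V \<and> lcs_zero ?E \<in> V \<and> V \<subseteq> U"
      if U: "openin (lcs_top ?E) U" "lcs_zero ?E \<in> U" for U
    proof -
      obtain T where T: "openin (powertop_real S) T" "U = T \<inter> F"
        using U(1) by (auto simp: openin_subtopology)
      have "(\<lambda>x\<in>S. 0) \<in> T" using U(2) T(2) by simp
      with T(1) have "\<exists>W. finite {i \<in> S. W i \<noteq> topspace euclideanreal} \<and>
          (\<forall>i\<in>S. openin euclideanreal (W i)) \<and> (\<lambda>x\<in>S. 0) \<in> Pi\<^sub>E S W \<and> Pi\<^sub>E S W \<subseteq> T"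
        unfolding openin_product_topology_alt by (rule bspec)
      then obtain W where W: "finite {i \<in> S. W i \<noteq> UNIV}" "\<And>i. i \<in> S \<Longrightarrow> open (W i)"
        "(\<lambda>x\<in>S. 0) \<in> Pi\<^sub>E S W" "Pi\<^sub>E S W \<subseteq> T"
        unfolding topspace_euclidean open_openin[symmetric] by blast
      have "\<forall>i\<in>S. \<exists>e>0. ball (0::real) e \<subseteq> W i"
      proof
        fix i assume i: "i \<in> S"
        then have "0 \<in> W i" using W(3) by (auto simp: PiE_iff)
        then show "\<exists>e>0. ball (0::real) e \<subseteq> W i"
          using W(2)[OF i] by (meson openE)
      qed
      then obtain e where e: "\<And>i. i \<in> S \<Longrightarrow> e i > 0" "\<And>i. i \<in> S \<Longrightarrow> ball (0::real) (e i) \<subseteq> W i"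
        by metis
      define B where "B i = (if W i = UNIV then UNIV else ball (0::real) (e i))" for i
      have fin: "finite {i \<in> S. B i \<noteq> UNIV}"
        by (rule finite_subset[OF _ W(1)]) (auto simp: B_def)
      have opB: "openin (powertop_real S) (Pi\<^sub>E S B)"
        unfolding openin_product_topology_alt
      proof
        fix x assume "x \<in> Pi\<^sub>E S B"
        then show "\<exists>U. finite {i \<in> S. U i \<noteq> topspace euclideanreal} \<and>
            (\<forall>i\<in>S. openin euclideanreal (U i)) \<and> x \<in> Pi\<^sub>E S U \<and> Pi\<^sub>E S U \<subseteq> Pi\<^sub>E S B"
          using fin by (intro exI[of _ B]) (auto simp: B_def)
      qed
      have cvx: "a * u + b * v \<in> B i" if "u \<in> B i" "v \<in> B i" "0 \<le> a" "0 \<le> b" "a + b = 1"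
        for a b u v :: real and i
      proof -
        have "convex (B i)" by (simp add: B_def)
        from convexD[OF this that] show ?thesis by simp
      qed
      have BW: "Pi\<^sub>E S B \<subseteq> Pi\<^sub>E S W"
        using e(2) by (intro PiE_mono) (auto simp: B_def)
      show ?thesis
      proof (intro exI[of _ "Pi\<^sub>E S B \<inter> F"] conjI)
        show "openin (lcs_top ?E) (Pi\<^sub>E S B \<inter> F)"
          using opB by (auto simp: openin_subtopology)
        show "lcs_convex ?E (Pi\<^sub>E S B \<inter> F)"
          unfolding lcs_convex_def
        proof (intro conjI ballI allI impI)
          show "Pi\<^sub>E S B \<inter> F \<subseteq> lcs_carrier ?E" using car by auto
        next
          fix u v and a b :: real
          assume uv: "u \<in> Pi\<^sub>E S B \<inter> F" "v \<in> Pi\<^sub>E S B \<inter> F" and ab: "0 \<le> a \<and> 0 \<le> b \<and> a + b = 1"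
          have "(\<lambda>x\<in>S. (\<lambda>x\<in>S. a * u x) x + (\<lambda>x\<in>S. b * v x) x) \<in> F"
            using uv by (intro sub(2) sub(3)) auto
          moreover have "a * u x + b * v x \<in> B x" if "x \<in> S" for x
            using uv ab that by (intro cvx) auto
          ultimately show "lcs_add ?E (lcs_scale ?E a u) (lcs_scale ?E b v) \<in> Pi\<^sub>E S B \<inter> F"
            by auto
        qed
        show "lcs_zero ?E \<in> Pi\<^sub>E S B \<inter> F"
          using sub(1) e(1) by (auto simp: B_def)
        show "Pi\<^sub>E S B \<inter> F \<subseteq> U" using T W BW by auto
      qed
    qed
  qed (use sub inter in \<open>auto simp: lcs_diff_def algebra_simps intro!: eqI restrict_extensional intro: ext'\<close>)
qed

lemma function_subspace_C_fun: "function_subspace (topspace X) (C_fun X)"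
proof -
  have restr: "continuous_map X euclideanreal (restrict h (topspace X))"
    if "continuous_map X euclideanreal h" for h
    by (rule continuous_map_eq[OF that]) simp
  show ?thesis
    unfolding function_subspace_def C_fun_def
    by (auto intro!: restr continuous_map_add continuous_map_real_mult_left)
qed

lemma function_subspace_pointwise_seq_limits:
  assumes "function_subspace S F"
  shows "function_subspace S (pointwise_seq_limits S F)"
  unfolding function_subspace_def
proof (intro conjI ballI allI)
  show "pointwise_seq_limits S F \<subseteq> extensional S"
    by (auto simp: pointwise_seq_limits_def)
  show "(\<lambda>x\<in>S. 0) \<in> pointwise_seq_limits S F"
    using assms unfolding pointwise_seq_limits_def function_subspace_def
    by (auto intro!: exI[of _ "\<lambda>n. \<lambda>x\<in>S. 0"])
next
  fix f g assume "f \<in> pointwise_seq_limits S F" "g \<in> pointwise_seq_limits S F"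
  then obtain f' g' where *: "\<And>n. f' n \<in> F" "\<And>n. g' n \<in> F"
    "\<And>x. x \<in> S \<Longrightarrow> (\<lambda>n. f' n x) \<longlonglongrightarrow> f x" "\<And>x. x \<in> S \<Longrightarrow> (\<lambda>n. g' n x) \<longlonglongrightarrow> g x"
    unfolding pointwise_seq_limits_def by blast
  then show "(\<lambda>x\<in>S. f x + g x) \<in> pointwise_seq_limits S F"
    using assms unfolding pointwise_seq_limits_def function_subspace_def
    by (auto intro!: exI[of _ "\<lambda>n. \<lambda>x\<in>S. f' n x + g' n x"] tendsto_add)
next
  fix c f assume "f \<in> pointwise_seq_limits S F"
  then obtain f' where *: "\<And>n. f' n \<in> F" "\<And>x. x \<in> S \<Longrightarrow> (\<lambda>n. f' n x) \<longlonglongrightarrow> f x"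
    unfolding pointwise_seq_limits_def by blast
  then show "(\<lambda>x\<in>S. c * f x) \<in> pointwise_seq_limits S F"
    using assms unfolding pointwise_seq_limits_def function_subspace_def
    by (auto intro!: exI[of _ "\<lambda>n. \<lambda>x\<in>S. c * f' n x"] tendsto_mult_left)
qed

lemma hausdorff_lcs_B1: "hausdorff_lcs (B1_lcs X)"
  unfolding B1_lcs_def B1_fun_def
  by (intro hausdorff_lcs_pointwise function_subspace_pointwise_seq_limits function_subspace_C_fun)

lemma carrier_B1_lcs: "lcs_carrier (B1_lcs X) = B1_fun X"
  unfolding B1_lcs_def
  by (rule carrier_pointwise_lcs) (auto simp: B1_fun_def pointwise_seq_limits_def)

end

theory Submission
  imports Defs
begin

text \<open>For a pointwise topology, Cauchy sequences are pointwise Cauchy sequences, so sequential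
  completeness of \<open>B\<^sub>1(X)\<close> says exactly \<open>B\<^sub>1(X) = B\<^sub>2(X)\<close>; and then sums of null sequences with
  coefficients in the unit ball of \<open>l1\<close> stay in \<open>B\<^sub>1(X)\<close>, which gives local completeness.
  Local completeness puts the indicator of every \<open>Zer\<^sub>\<sigma>\<close>-set in \<open>B\<^sub>1(X)\<close>, as a dyadic series over a
  null sequence, and a set whose indicator is Baire-one is \<open>Coz\<^sub>\<delta>\<close>. In a CZ-space the
  \<open>Zer\<^sub>\<sigma>\<close>-sets form a sigma-algebra for which all functions in \<open>B\<^sub>2(X)\<close> are measurable; indicators of
  its members are limits of continuous functions because disjoint zero-sets are completely separated,
  and a binary expansion extends this to all measurable functions.\<close>

section \<open>Completeness of spaces of real functions\<close>

lemma limitin_pointwise_lcs: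
  assumes "F \<subseteq> extensional S"
  shows "limitin (lcs_top (pointwise_lcs S F)) \<sigma> l G \<longleftrightarrow>
    l \<in> F \<and> (\<forall>\<^sub>F n in G. \<sigma> n \<in> F) \<and> (\<forall>x\<in>S. ((\<lambda>n. \<sigma> n x) \<longlongrightarrow> l x) G)"
proof -
  have "\<forall>\<^sub>F n in G. \<sigma> n \<in> extensional S" if "\<forall>\<^sub>F n in G. \<sigma> n \<in> F"
    using that by (rule eventually_mono) (use assms in auto)
  then show ?thesis
    using assms by (auto simp: limitin_subtopology limitin_componentwise PiE_def)
qed

text \<open>A sequence is Cauchy iff its double sequence of differences tends to zero along
  \<open>sequentially \<times>\<^sub>F sequentially\<close>. This turns the condition into a limit,
  which can be tested coordinate by coordinate.\<close>

lemma lcs_Cauchy_pointwise_lcs: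
  assumes F: "function_subspace S F"
  shows "lcs_Cauchy (pointwise_lcs S F) \<sigma> \<longleftrightarrow>
    range \<sigma> \<subseteq> F \<and> (\<forall>x\<in>S. Cauchy (\<lambda>n. \<sigma> n x))"
proof -
  let ?E = "pointwise_lcs S F"
  let ?d = "\<lambda>(m, n). lcs_diff ?E (\<sigma> m) (\<sigma> n)"
  have ext: "F \<subseteq> extensional S" using F by (simp add: function_subspace_def)
  note car = carrier_pointwise_lcs[OF ext]
  interpret hausdorff_lcs ?E by (rule hausdorff_lcs_pointwise[OF F])
  have ev: "(\<forall>\<^sub>F p in sequentially \<times>\<^sub>F sequentially. case p of (m, n) \<Rightarrow> P m n) \<longleftrightarrow>
      (\<exists>N. \<forall>m\<ge>N. \<forall>n\<ge>N. P m n)" for P :: "nat \<Rightarrow> nat \<Rightarrow> bool"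
    unfolding eventually_prod_sequentially by auto
  have "lcs_Cauchy ?E \<sigma> \<longleftrightarrow>
      range \<sigma> \<subseteq> F \<and> limitin (lcs_top ?E) ?d (lcs_zero ?E) (sequentially \<times>\<^sub>F sequentially)"
    using zero_closed ev[of "\<lambda>m n. lcs_diff ?E (\<sigma> m) (\<sigma> n) \<in> U" for U]
    unfolding lcs_Cauchy_def limitin_def car
    by (simp add: case_prod_unfold del: pointwise_lcs_simps)
  also have "\<dots> \<longleftrightarrow> range \<sigma> \<subseteq> F \<and> (\<forall>x\<in>S. Cauchy (\<lambda>n. \<sigma> n x))"
  proof (rule conj_cong[OF refl])
    assume \<sigma>: "range \<sigma> \<subseteq> F"
    have "?d p \<in> F" for p
      using \<sigma> unfolding lcs_diff_def case_prod_unfold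
      by (intro add_closed[unfolded car] scale_closed[unfolded car]) auto
    moreover have "((\<lambda>p. ?d p x) \<longlongrightarrow> 0) (sequentially \<times>\<^sub>F sequentially) \<longleftrightarrow> Cauchy (\<lambda>n. \<sigma> n x)"
      if "x \<in> S" for x
      using that ev[of "\<lambda>m n. dist (\<sigma> m x) (\<sigma> n x) < e" for e]
      unfolding tendsto_iff Cauchy_def
      by (simp add: case_prod_unfold lcs_diff_def dist_real_def)
    ultimately show "limitin (lcs_top ?E) ?d (lcs_zero ?E) (sequentially \<times>\<^sub>F sequentially)
        \<longleftrightarrow> (\<forall>x\<in>S. Cauchy (\<lambda>n. \<sigma> n x))"
      using zero_closed[unfolded car] unfolding limitin_pointwise_lcs[OF ext] by simp
  qed
  finally show ?thesis .
qed

lemma pointwise_seq_limitsE: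
  assumes "f \<in> pointwise_seq_limits S F"
  obtains g :: "nat \<Rightarrow> 'a \<Rightarrow> real"
  where "f \<in> extensional S" "\<And>n. g n \<in> F" "\<And>x. x \<in> S \<Longrightarrow> (\<lambda>n. g n x) \<longlonglongrightarrow> f x"
proof -
  from assms have "f \<in> extensional S"
    "\<exists>g :: nat \<Rightarrow> 'a \<Rightarrow> real. (\<forall>n. g n \<in> F) \<and> (\<forall>x\<in>S. (\<lambda>n. g n x) \<longlonglongrightarrow> f x)"
    by (simp_all add: pointwise_seq_limits_def)
  with that show ?thesis by blast
qed

lemma subset_pointwise_seq_limits:
  assumes "F \<subseteq> extensional S"
  shows "F \<subseteq> pointwise_seq_limits S F"
proof
  fix f assume "f \<in> F"
  then show "f \<in> pointwise_seq_limits S F"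
    using assms unfolding pointwise_seq_limits_def by (auto intro!: exI[of _ "\<lambda>n. f"])
qed

text \<open>A pointwise convergent sequence in \<open>F\<close> is Cauchy, and any limit it has in
  the space must be its pointwise limit. Conversely, completeness of the reals gives every Cauchy
  sequence a pointwise limit.\<close>

lemma sequentially_complete_pointwise_lcs:
  assumes F: "function_subspace S F"
  shows "sequentially_complete (pointwise_lcs S F) \<longleftrightarrow> F = pointwise_seq_limits S F"
proof
  have ext: "F \<subseteq> extensional S" using F by (simp add: function_subspace_def)
  assume seq: "sequentially_complete (pointwise_lcs S F)"
  have "f \<in> F" if lim: "f \<in> pointwise_seq_limits S F" for f
  proof -
    obtain g where f: "f \<in> extensional S" and g: "\<And>n. g n \<in> F"
      "\<And>x. x \<in> S \<Longrightarrow> (\<lambda>n. g n x) \<longlonglongrightarrow> f x"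
      using lim by (rule pointwise_seq_limitsE) blast
    have "lcs_Cauchy (pointwise_lcs S F) g"
      using g by (auto simp: lcs_Cauchy_pointwise_lcs[OF F] intro: LIMSEQ_imp_Cauchy)
    then obtain l where "limitin (lcs_top (pointwise_lcs S F)) g l sequentially"
      using seq unfolding sequentially_complete_def by blast
    then have l: "l \<in> F" "\<And>x. x \<in> S \<Longrightarrow> (\<lambda>n. g n x) \<longlonglongrightarrow> l x"
      by (auto simp: limitin_pointwise_lcs[OF ext] simp del: pointwise_lcs_simps)
    have "f = l"
      using f l(1) ext g(2) l(2) by (intro extensionalityI[of f S l]) (auto intro: LIMSEQ_unique)
    with l show ?thesis by simp
  qed
  with subset_pointwise_seq_limits[OF ext] show "F = pointwise_seq_limits S F" by blast
next
  have ext: "F \<subseteq> extensional S" using F by (simp add: function_subspace_def)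
  assume eq: "F = pointwise_seq_limits S F"
  show "sequentially_complete (pointwise_lcs S F)"
    unfolding sequentially_complete_def lcs_Cauchy_pointwise_lcs[OF F]
  proof (intro allI impI)
    fix \<sigma> assume \<sigma>: "range \<sigma> \<subseteq> F \<and> (\<forall>x\<in>S. Cauchy (\<lambda>n. \<sigma> n x))"
    define l where "l = (\<lambda>x\<in>S. lim (\<lambda>n. \<sigma> n x))"
    have lim: "(\<lambda>n. \<sigma> n x) \<longlonglongrightarrow> l x" if "x \<in> S" for x
      using that \<sigma> by (simp add: l_def Cauchy_convergent convergent_LIMSEQ_iff[symmetric])
    then have "l \<in> pointwise_seq_limits S F"
      using \<sigma> unfolding pointwise_seq_limits_def l_def by (auto intro!: exI[of _ \<sigma>])
    then have "l \<in> F" using eq by simp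
    moreover have "\<forall>\<^sub>F n in sequentially. \<sigma> n \<in> F" using \<sigma> by (intro always_eventually) auto
    ultimately show "\<exists>l. limitin (lcs_top (pointwise_lcs S F)) \<sigma> l sequentially"
      using lim unfolding limitin_pointwise_lcs[OF ext] by blast
  qed
qed

subsection \<open>Absolutely convex hulls of null sequences\<close>

text \<open>The closed unit ball of l1. Bounding partial sums makes every condition depend on
  finitely many coordinates, so the set is closed in the product topology.\<close>

definition l1_ball :: "(nat \<Rightarrow> real) set"
  where "l1_ball = {a. \<forall>N. (\<Sum>n<N. \<bar>a n\<bar>) \<le> 1}"

text \<open>A closed subset of a product of intervals, which is compact by the Tychonoff
  theorem.\<close>

lemma compact_l1_ball: "compact l1_ball"
proof -
  have "compactin (powertop_real (UNIV :: nat set)) (PiE UNIV (\<lambda>n. {-1..1}))"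
    by (simp add: compactin_PiE)
  then have cpt: "compact (PiE UNIV (\<lambda>n. {-1..1}) :: (nat \<Rightarrow> real) set)"
    by (simp add: euclidean_product_topology)
  have "closed l1_ball"
    unfolding l1_ball_def
    by (intro closed_Collect_all closed_Collect_le continuous_intros continuous_on_product_coordinates)
  moreover have "l1_ball \<subseteq> PiE UNIV (\<lambda>n. {-1..1})"
  proof
    fix a assume a: "a \<in> l1_ball"
    have "\<bar>a n\<bar> \<le> 1" for n
    proof -
      have "\<bar>a n\<bar> \<le> (\<Sum>n<Suc n. \<bar>a n\<bar>)" by (simp add: sum_nonneg)
      also have "\<dots> \<le> 1" using a unfolding l1_ball_def by blast
      finally show ?thesis .
    qed
    then show "a \<in> PiE UNIV (\<lambda>n. {-1..1})" by (auto simp: abs_le_iff; smt (verit))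
  qed
  ultimately show ?thesis
    using compact_Int_closed[OF cpt] by (metis Int_absorb1)
qed

text \<open>The condition on \<open>s\<close> and \<open>t\<close> covers convex combinations as
  well as, with \<open>t = 0\<close>, multiples by scalars of modulus at most 1.\<close>

lemma l1_ball_combination:
  assumes "a \<in> l1_ball" "b \<in> l1_ball" "\<bar>s\<bar> + \<bar>t\<bar> \<le> 1"
  shows "(\<lambda>n. s * a n + t * b n) \<in> l1_ball"
  unfolding l1_ball_def
proof safe
  fix N
  have "(\<Sum>n<N. \<bar>s * a n + t * b n\<bar>) \<le> (\<Sum>n<N. \<bar>s\<bar> * \<bar>a n\<bar> + \<bar>t\<bar> * \<bar>b n\<bar>)"
    by (intro sum_mono) (metis abs_mult abs_triangle_ineq)
  also have "\<dots> = \<bar>s\<bar> * (\<Sum>n<N. \<bar>a n\<bar>) + \<bar>t\<bar> * (\<Sum>n<N. \<bar>b n\<bar>)"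
    by (simp add: sum.distrib sum_distrib_left)
  also have "\<dots> \<le> \<bar>s\<bar> * 1 + \<bar>t\<bar> * 1"
    using assms by (intro add_mono mult_left_mono) (auto simp: l1_ball_def)
  finally show "(\<Sum>n<N. \<bar>s * a n + t * b n\<bar>) \<le> 1" using assms by simp
qed

text \<open>A block of the series is at most the supremum of \<bar>c n\<bar> over the block times
  the l1-norm of \<open>a\<close>, so the Cauchy estimate is uniform over the ball. Uniformity makes
  the sum continuous in \<open>a\<close>.\<close>

lemma uniform_limit_l1_ball_series:
  fixes c :: "nat \<Rightarrow> real"
  assumes "c \<longlonglongrightarrow> 0"
  shows "uniform_limit l1_ball (\<lambda>N a. \<Sum>n<N. a n * c n) (\<lambda>a. \<Sum>n. a n * c n) sequentially"
proof -
  have "uniformly_Cauchy_on l1_ball (\<lambda>N a. \<Sum>n<N. a n * c n)"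
  proof (rule uniformly_Cauchy_onI')
    fix e :: real assume e: "e > 0"
    then obtain M where M: "\<And>n. n \<ge> M \<Longrightarrow> \<bar>c n\<bar> < e / 2"
      using LIMSEQ_D[OF assms, of "e / 2"] by auto
    show "\<exists>M. \<forall>a\<in>l1_ball. \<forall>m\<ge>M. \<forall>N>m. dist (\<Sum>n<m. a n * c n) (\<Sum>n<N. a n * c n) < e"
    proof (intro exI[of _ M] ballI allI impI)
      fix a m N assume a: "a \<in> l1_ball" and mN: "M \<le> m" "m < N"
      have "dist (\<Sum>n<m. a n * c n) (\<Sum>n<N. a n * c n) = \<bar>\<Sum>n=m..<N. a n * c n\<bar>"
        using mN by (simp add: dist_real_def atLeast0LessThan[symmetric] abs_minus_commute sum_diff_nat_ivl)
      also have "\<dots> \<le> (\<Sum>n=m..<N. \<bar>a n\<bar> * (e / 2))"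
      proof (rule order_trans[OF sum_abs], rule sum_mono)
        fix n assume "n \<in> {m..<N}"
        then show "\<bar>a n * c n\<bar> \<le> \<bar>a n\<bar> * (e / 2)"
          unfolding abs_mult using M[of n] mN by (intro mult_left_mono) auto
      qed
      also have "\<dots> \<le> (\<Sum>n<N. \<bar>a n\<bar> * (e / 2))"
        using e by (intro sum_mono2) auto
      also have "\<dots> = (\<Sum>n<N. \<bar>a n\<bar>) * (e / 2)" by (simp add: sum_distrib_right)
      also have "\<dots> \<le> 1 * (e / 2)"
        using a e by (intro mult_right_mono) (auto simp: l1_ball_def)
      finally show "dist (\<Sum>n<m. a n * c n) (\<Sum>n<N. a n * c n) < e" using e by simp
    qed
  qed
  then have "uniformly_convergent_on l1_ball (\<lambda>N a. \<Sum>n<N. a n * c n)"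
    by (rule Cauchy_uniformly_convergent)
  then show ?thesis
    by (simp add: uniformly_convergent_uniform_limit_iff suminf_eq_lim)
qed

text \<open>The weak-star compact unit ball of \<open>l1\<close> is mapped onto an absolutely convex set containing
  the null sequence.\<close>

lemma locally_complete_pointwise_lcs:
  assumes F: "function_subspace S F" and lim: "pointwise_seq_limits S F \<subseteq> F"
  shows "locally_complete (pointwise_lcs S F)"
  unfolding locally_complete_def
proof (intro allI impI)
  fix \<sigma> assume null: "null_sequence (pointwise_lcs S F) \<sigma>"
  let ?E = "pointwise_lcs S F"
  interpret hausdorff_lcs ?E by (rule hausdorff_lcs_pointwise[OF F])
  have ext: "F \<subseteq> extensional S" using F by (simp add: function_subspace_def)
  note car = carrier_pointwise_lcs[OF ext]
  have \<sigma>: "\<sigma> n \<in> F" for n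
    using null unfolding null_sequence_def car by auto
  have lim0: "(\<lambda>n. \<sigma> n x) \<longlonglongrightarrow> 0" if "x \<in> S" for x
    using null that unfolding null_sequence_def limitin_pointwise_lcs[OF ext] by auto
  define \<Phi> where "\<Phi> a = (\<lambda>x\<in>S. \<Sum>n. a n * \<sigma> n x)" for a
  have ulim: "uniform_limit l1_ball (\<lambda>N a. \<Sum>n<N. a n * \<sigma> n x) (\<lambda>a. \<Sum>n. a n * \<sigma> n x) sequentially"
    if "x \<in> S" for x
    using uniform_limit_l1_ball_series[OF lim0[OF that]] .
  have sums: "(\<lambda>n. a n * \<sigma> n x) sums \<Phi> a x" if "x \<in> S" "a \<in> l1_ball" for a x
    using tendsto_uniform_limitI[OF ulim[OF that(1)] that(2)] that(1)
    by (simp add: sums_def \<Phi>_def)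
  have partial: "(\<lambda>x\<in>S. \<Sum>n<N. a n * \<sigma> n x) \<in> F" for a :: "nat \<Rightarrow> real" and N
  proof (induction N)
    case 0
    have "(\<lambda>x\<in>S. 0) \<in> F" using F unfolding function_subspace_def by blast
    then show ?case by (simp only: lessThan_0 sum.empty)
  next
    case (Suc N)
    have "(\<lambda>x\<in>S. (\<lambda>x\<in>S. \<Sum>n<N. a n * \<sigma> n x) x + (\<lambda>x\<in>S. a N * \<sigma> N x) x) \<in> F"
      using F Suc \<sigma>[of N] unfolding function_subspace_def by blast
    also have "(\<lambda>x\<in>S. (\<lambda>x\<in>S. \<Sum>n<N. a n * \<sigma> n x) x + (\<lambda>x\<in>S. a N * \<sigma> N x) x) =
        (\<lambda>x\<in>S. \<Sum>n<Suc N. a n * \<sigma> n x)"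
      by (rule restrict_ext) simp
    finally show ?case .
  qed
  \<comment> \<open>Closure of \<open>F\<close> under sequential limits enters here:
    \<open>\<Phi> a\<close> is the pointwise limit of partial sums in \<open>F\<close>.\<close>
  have \<Phi>F: "\<Phi> a \<in> F" if "a \<in> l1_ball" for a
  proof (rule subsetD[OF lim])
    show "\<Phi> a \<in> pointwise_seq_limits S F"
      using partial[of a] sums[OF _ that] unfolding pointwise_seq_limits_def
      by (auto simp: \<Phi>_def sums_def intro!: exI[of _ "\<lambda>N. \<lambda>x\<in>S. \<Sum>n<N. a n * \<sigma> n x"])
  qed
  have cont: "continuous_map (top_of_set l1_ball) (powertop_real S) \<Phi>"
    unfolding continuous_map_componentwise
  proof (intro conjI ballI)
    show "\<Phi> ` topspace (top_of_set l1_ball) \<subseteq> extensional S" by (auto simp: \<Phi>_def)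
    fix x assume x: "x \<in> S"
    have "continuous_on l1_ball (\<lambda>a. \<Sum>n. a n * \<sigma> n x)"
      by (rule uniform_limit_theorem[OF _ ulim[OF x]])
        (auto intro!: always_eventually continuous_intros continuous_on_product_coordinates
          continuous_on_subset[OF continuous_on_product_coordinates])
    then show "continuous_map (top_of_set l1_ball) euclideanreal (\<lambda>a. \<Phi> a x)"
      using x by (simp add: \<Phi>_def)
  qed
  define K where "K = \<Phi> ` l1_ball"
  have "compactin (powertop_real S) K"
    unfolding K_def
    by (rule image_compactin[OF _ cont]) (simp add: compactin_subtopology compact_l1_ball)
  then have cpt: "compactin (lcs_top ?E) K"
    using \<Phi>F by (auto simp: K_def compactin_subtopology)
  have comb: "(\<lambda>x\<in>S. s * \<Phi> a x + t * \<Phi> b x) \<in> K"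
    if ab: "a \<in> l1_ball" "b \<in> l1_ball" and st: "\<bar>s\<bar> + \<bar>t\<bar> \<le> 1" for a b s t
  proof -
    let ?c = "\<lambda>n. s * a n + t * b n"
    have c: "?c \<in> l1_ball" by (rule l1_ball_combination[OF ab st])
    have "s * \<Phi> a x + t * \<Phi> b x = \<Phi> ?c x" if x: "x \<in> S" for x
      using sums_unique2[OF sums_add[OF sums_mult[OF sums[OF x ab(1)], of s] sums_mult[OF sums[OF x ab(2)], of t]],
          of "\<Phi> ?c x"] sums[OF x c]
      by (simp add: algebra_simps)
    then have "(\<lambda>x\<in>S. s * \<Phi> a x + t * \<Phi> b x) = \<Phi> ?c"
      by (intro extensionalityI[of _ S]) (auto simp: \<Phi>_def)
    with c show ?thesis by (simp add: K_def)
  qed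
  have "absolutely_convex ?E K"
    unfolding absolutely_convex_def lcs_convex_def lcs_balanced_def
  proof (intro conjI ballI allI impI)
    show "K \<subseteq> lcs_carrier ?E" "K \<subseteq> lcs_carrier ?E"
      using \<Phi>F unfolding car K_def by auto
  next
    fix u v and s t :: real assume "u \<in> K" "v \<in> K" "0 \<le> s \<and> 0 \<le> t \<and> s + t = 1"
    then show "lcs_add ?E (lcs_scale ?E s u) (lcs_scale ?E t v) \<in> K"
      using comb[of _ _ s t] by (auto simp: K_def cong: restrict_cong)
  next
    fix u and c :: real assume "u \<in> K" "\<bar>c\<bar> \<le> 1"
    then show "lcs_scale ?E c u \<in> K"
      using comb[of _ _ c 0] by (auto simp: K_def)
  qed
  moreover have "range \<sigma> \<subseteq> K"
  proof safe
    fix n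
    define a :: "nat \<Rightarrow> real" where "a k = (if k = n then 1 else 0)" for k
    have a: "a \<in> l1_ball"
      by (auto simp: l1_ball_def a_def if_distrib[of abs] cong: if_cong)
    have "\<sigma> n x = \<Phi> a x" if "x \<in> S" for x
    proof (rule sums_unique2)
      show "(\<lambda>k. a k * \<sigma> k x) sums \<Phi> a x" by (rule sums[OF that a])
      have "(\<lambda>k. if k = n then \<sigma> k x else 0) sums \<sigma> n x" by (rule sums_single)
      then show "(\<lambda>k. a k * \<sigma> k x) sums \<sigma> n x"
        by (rule sums_cong[THEN iffD1, rotated]) (simp add: a_def)
    qed
    then have "\<sigma> n = \<Phi> a"
      using \<sigma>[of n] ext by (intro extensionalityI[of _ S]) (auto simp: \<Phi>_def)
    with a show "\<sigma> n \<in> K" by (simp add: K_def)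
  qed
  \<comment> \<open>Being compact in a Hausdorff space, \<open>K\<close> is closed and so is one of
    the sets intersected in the hull.\<close>
  ultimately have "closed_absolutely_convex_hull ?E (range \<sigma>) \<subseteq> K"
    unfolding closed_absolutely_convex_hull_def
    using compactin_imp_closedin[OF hausdorff cpt] by (intro hull_minimal) auto
  \<comment> \<open>An intersection of closed sets is closed if the family is nonempty;
    \<open>K\<close> is a member.\<close>
  moreover have "closedin (lcs_top ?E) (closed_absolutely_convex_hull ?E (range \<sigma>))"
    unfolding closed_absolutely_convex_hull_def hull_def
    using \<open>range \<sigma> \<subseteq> K\<close> \<open>absolutely_convex ?E K\<close> compactin_imp_closedin[OF hausdorff cpt]
    by (intro closedin_Inter) auto
  ultimately show "compactin (lcs_top ?E) (closed_absolutely_convex_hull ?E (range \<sigma>))"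
    using closed_compactin[OF cpt] by blast
qed

section \<open>Dyadic series in locally complete function spaces\<close>

text \<open>The sum of \<open>Suc N\<close> terms is the midpoint of \<open>\<sigma> 0\<close> and
  the sum of \<open>N\<close> terms for the shifted sequence; hence the induction generalizes over
  \<open>\<sigma>\<close>. The empty sum arises by scaling some element of \<open>K\<close> by
  0.\<close>

lemma absolutely_convex_dyadic_sum:
  assumes K: "absolutely_convex (pointwise_lcs S F) K" and "range \<sigma> \<subseteq> K" "K \<noteq> {}"
  shows "(\<lambda>x\<in>S. \<Sum>n<N. \<sigma> n x / 2 ^ Suc n) \<in> K"
  using assms(2)
proof (induction N arbitrary: \<sigma>)
  case 0
  obtain u where "u \<in> K" using assms(3) by blast
  moreover have "\<bar>0 :: real\<bar> \<le> 1" by simp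
  ultimately have "lcs_scale (pointwise_lcs S F) 0 u \<in> K"
    using K unfolding absolutely_convex_def lcs_balanced_def by blast
  then show ?case by (simp only: pointwise_lcs_simps lessThan_0 sum.empty mult_zero_left)
next
  case (Suc N)
  have "(\<lambda>x\<in>S. \<Sum>n<N. \<sigma> (Suc n) x / 2 ^ Suc n) \<in> K"
    using Suc.prems by (intro Suc.IH) auto
  moreover have "\<sigma> 0 \<in> K" using Suc.prems by auto
  moreover have "(0::real) \<le> 1/2 \<and> (0::real) \<le> 1/2 \<and> 1/2 + 1/2 = (1::real)" by simp
  ultimately have "lcs_add (pointwise_lcs S F) (lcs_scale (pointwise_lcs S F) (1/2) (\<sigma> 0))
      (lcs_scale (pointwise_lcs S F) (1/2) (\<lambda>x\<in>S. \<Sum>n<N. \<sigma> (Suc n) x / 2 ^ Suc n)) \<in> K"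
    using K unfolding absolutely_convex_def lcs_convex_def by blast
  also have "lcs_add (pointwise_lcs S F) (lcs_scale (pointwise_lcs S F) (1/2) (\<sigma> 0))
      (lcs_scale (pointwise_lcs S F) (1/2) (\<lambda>x\<in>S. \<Sum>n<N. \<sigma> (Suc n) x / 2 ^ Suc n)) =
      (\<lambda>x\<in>S. \<Sum>n<Suc N. \<sigma> n x / 2 ^ Suc n)"
    unfolding pointwise_lcs_simps
    by (rule restrict_ext)
      (simp add: sum.lessThan_Suc_shift sum_divide_distrib algebra_simps del: sum.lessThan_Suc)
  finally show ?case .
qed

text \<open>The partial sums stay in the closed absolutely convex hull of the null sequence, and
  compactness of this hull keeps their limit inside \<open>F\<close>.\<close>

lemma locally_complete_dyadic_series:
  assumes F: "function_subspace S F" and "locally_complete (pointwise_lcs S F)"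
    and \<sigma>: "\<And>n. \<sigma> n \<in> F" and lim0: "\<And>x. x \<in> S \<Longrightarrow> (\<lambda>n. \<sigma> n x) \<longlonglongrightarrow> 0"
    and g: "g \<in> extensional S" "\<And>x. x \<in> S \<Longrightarrow> (\<lambda>n. \<sigma> n x / 2 ^ Suc n) sums g x"
  shows "g \<in> F"
proof -
  let ?E = "pointwise_lcs S F"
  interpret hausdorff_lcs ?E by (rule hausdorff_lcs_pointwise[OF F])
  have ext: "F \<subseteq> extensional S" using F by (simp add: function_subspace_def)
  note car = carrier_pointwise_lcs[OF ext]
  define K where "K = closed_absolutely_convex_hull ?E (range \<sigma>)"
  have "null_sequence ?E \<sigma>"
    using \<sigma> lim0 zero_closed unfolding null_sequence_def car limitin_pointwise_lcs[OF ext] by auto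
  then have cpt: "compactin (lcs_top ?E) K"
    using assms(2) unfolding locally_complete_def K_def by blast
  have sub: "range \<sigma> \<subseteq> K"
    unfolding K_def closed_absolutely_convex_hull_def by (rule hull_subset)
  have KF: "K \<subseteq> F" using compactin_subset_topspace[OF cpt] unfolding car .
  \<comment> \<open>Inclusion in the carrier comes from compactness; the closure conditions pass to
    intersections.\<close>
  have "absolutely_convex ?E K"
    unfolding absolutely_convex_def lcs_convex_def lcs_balanced_def
  proof (intro conjI ballI allI impI)
    show "K \<subseteq> lcs_carrier ?E" "K \<subseteq> lcs_carrier ?E" using KF unfolding car by auto
  qed (simp_all only: K_def closed_absolutely_convex_hull_def hull_def Inter_iff mem_Collect_eq
      absolutely_convex_def lcs_convex_def lcs_balanced_def, blast+)
  then have mem: "(\<lambda>x\<in>S. \<Sum>n<N. \<sigma> n x / 2 ^ Suc n) \<in> K" for N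
    using sub by (intro absolutely_convex_dyadic_sum) auto
  \<comment> \<open>Unlike closedness, compactness does not depend on the ambient space. So
    \<open>K\<close> is closed in the full product, where \<open>g\<close> can be tested before it
    is known to lie in \<open>F\<close>.\<close>
  have "compactin (powertop_real S) K"
    using cpt by (simp add: compactin_subtopology)
  then have "closedin (powertop_real S) K"
    by (intro compactin_imp_closedin) (auto simp: Hausdorff_space_product_topology)
  moreover have "limitin (powertop_real S) (\<lambda>N. \<lambda>x\<in>S. \<Sum>n<N. \<sigma> n x / 2 ^ Suc n) g sequentially"
    using g by (auto simp: limitin_componentwise sums_def)
  ultimately have "g \<in> K"
    using mem by (intro limitin_closedin) auto
  with KF show ?thesis by blast
qed


section \<open>Zero-sets and Baire-one functions\<close>

lemma zero_set_subset: "zero_set X A \<Longrightarrow> A \<subseteq> topspace X"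
  by (auto simp: zero_set_def)

lemma zero_set_empty: "zero_set X {}"
  unfolding zero_set_def by (rule exI[of _ "\<lambda>x. 1"]) simp

lemma zero_set_Un:
  assumes "zero_set X A" "zero_set X B"
  shows "zero_set X (A \<union> B)"
proof -
  obtain f g where "continuous_map X euclideanreal f" "A = {x \<in> topspace X. f x = 0}"
    "continuous_map X euclideanreal g" "B = {x \<in> topspace X. g x = 0}"
    using assms unfolding zero_set_def by blast
  then show ?thesis
    unfolding zero_set_def
    by (intro exI[of _ "\<lambda>x. f x * g x"]) (auto intro: continuous_map_real_mult)
qed

lemma zero_set_finite_UN:
  assumes "finite I" "\<And>i. i \<in> I \<Longrightarrow> zero_set X (A i)"
  shows "zero_set X (\<Union>i\<in>I. A i)"
  using assms by (induction I rule: finite_induct) (auto intro: zero_set_empty zero_set_Un)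

lemma zero_set_le:
  assumes "continuous_map X euclideanreal g"
  shows "zero_set X {x \<in> topspace X. g x \<le> a}"
  unfolding zero_set_def
  by (rule exI[of _ "\<lambda>x. max 0 (g x - a)"])
    (intro conjI continuous_intros assms, auto simp: max_def)

text \<open>A series of nonnegative functions vanishes exactly where all its terms do. Truncation at
  1 and geometric weights make it converge uniformly, so its sum is continuous.\<close>

lemma zero_set_INT:
  fixes A :: "nat \<Rightarrow> 'a set"
  assumes "\<And>n. zero_set X (A n)"
  shows "zero_set X (\<Inter>n. A n)"
proof -
  obtain f where f: "\<And>n. continuous_map X euclideanreal (f n)"
    "\<And>n. A n = {x \<in> topspace X. f n x = 0}"
    using assms unfolding zero_set_def by metis
  define h where "h n x = (1/2) ^ n * min 1 \<bar>f n x\<bar>" for n x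
  have h: "0 \<le> h n x" "h n x \<le> (1/2) ^ n" for n x
    by (simp_all add: h_def mult_le_cancel_left1)
  have summ: "summable (\<lambda>n. h n x)" for x
    by (rule summable_comparison_test[of _ "\<lambda>n. (1/2) ^ n"])
      (use h in \<open>auto intro!: exI[of _ 0] summable_geometric\<close>)
  have ulim: "uniform_limit (topspace X) (\<lambda>N x. \<Sum>n<N. h n x) (\<lambda>x. \<Sum>n. h n x) sequentially"
    by (rule Weierstrass_m_test[of _ _ "\<lambda>n. (1/2) ^ n"]) (use h in auto)
  \<comment> \<open>\<open>Met_TC.mtopology\<close> is the euclidean topology in the form used by
    the uniform limit theorem for maps from an abstract topology.\<close>
  have "continuous_map X Met_TC.mtopology (\<lambda>x. \<Sum>n. h n x)"
  proof (rule Met_TC.continuous_map_uniform_limit[where F = sequentially])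
    show "\<forall>\<^sub>F N in sequentially. continuous_map X Met_TC.mtopology (\<lambda>x. \<Sum>n<N. h n x)"
      unfolding mtopology_is_euclidean h_def
      by (intro always_eventually allI continuous_intros f) auto
    fix e :: real assume "e > 0"
    then show "\<forall>\<^sub>F N in sequentially. \<forall>x\<in>topspace X.
        (\<Sum>n. h n x) \<in> UNIV \<and> dist (\<Sum>n<N. h n x) (\<Sum>n. h n x) < e"
      using ulim by (simp add: uniform_limit_iff)
  qed simp
  moreover have "(\<Inter>n. A n) = {x \<in> topspace X. (\<Sum>n. h n x) = 0}"
    using suminf_eq_zero_iff[OF summ h(1)] by (auto simp: f(2) h_def min_def split: if_splits)
  ultimately show ?thesis
    unfolding zero_set_def mtopology_is_euclidean by blast
qed

section \<open>Countable unions of zero-sets and their complements\<close>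

lemma zer_sigma_incseq:
  assumes "zer_sigma X A"
  obtains Z :: "nat \<Rightarrow> 'a set"
  where "\<And>n. zero_set X (Z n)" "incseq Z" "A = (\<Union>n. Z n)"
proof -
  obtain \<U> where \<U>: "countable \<U>" "\<U> \<subseteq> Collect (zero_set X)" "A = \<Union>\<U>"
    using assms unfolding zer_sigma_def union_of_def by auto
  \<comment> \<open>The added empty set makes the family nonempty, so that it can be enumerated even
    if \<open>\<U>\<close> is empty.\<close>
  define W where "W = from_nat_into (insert {} \<U>)"
  have ran: "range W = insert {} \<U>"
    unfolding W_def using \<U>(1) by (intro range_from_nat_into) auto
  have W: "zero_set X (W n)" for n
    using rangeI[of W n] \<U>(2) zero_set_empty unfolding ran by auto
  show ?thesis
  proof
    show "zero_set X (\<Union>i\<le>n. W i)" for n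
      by (intro zero_set_finite_UN W) simp
    show "incseq (\<lambda>n. \<Union>i\<le>n. W i)"
      by (intro incseq_SucI UN_mono) auto
    have "\<Union>\<U> = \<Union>(range W)" by (simp add: ran)
    then show "A = (\<Union>n. \<Union>i\<le>n. W i)" using \<U>(3) by auto
  qed
qed

lemma zer_sigma_zero_set: "zero_set X A \<Longrightarrow> zer_sigma X A"
  unfolding zer_sigma_def by (rule countable_union_of_inc)

lemma zer_sigma_UN:
  fixes A :: "nat \<Rightarrow> 'a set"
  assumes "\<And>n. zer_sigma X (A n)"
  shows "zer_sigma X (\<Union>n. A n)"
  using assms unfolding zer_sigma_def by (intro countable_union_of_Union) auto

lemma coz_delta_iff_zer_sigma:
  assumes A: "A \<subseteq> topspace X"
  shows "coz_delta X A \<longleftrightarrow> zer_sigma X (topspace X - A)"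
proof
  let ?S = "topspace X"
  assume "coz_delta X A"
  then obtain \<U> where \<U>: "countable \<U>" "\<U> \<subseteq> Collect (cozero_set X)" "A = ?S \<inter> \<Inter>\<U>"
    unfolding coz_delta_def relative_to_def intersection_of_def by auto
  have "zero_set X (?S - U)" if U: "U \<in> \<U>" for U
  proof -
    obtain Z where Z: "zero_set X Z" "U = ?S - Z"
      using U \<U>(2) unfolding cozero_set_def by blast
    then have "?S - U = Z" using zero_set_subset[OF Z(1)] by blast
    with Z show ?thesis by simp
  qed
  moreover have "?S - A = \<Union>((\<lambda>U. ?S - U) ` \<U>)" using \<U>(3) by auto
  ultimately show "zer_sigma X (?S - A)"
    unfolding zer_sigma_def union_of_def using \<U>(1)
    by (intro exI[of _ "(\<lambda>U. ?S - U) ` \<U>"]) auto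
next
  let ?S = "topspace X"
  assume "zer_sigma X (?S - A)"
  then obtain \<U> where \<U>: "countable \<U>" "\<U> \<subseteq> Collect (zero_set X)" "?S - A = \<Union>\<U>"
    unfolding zer_sigma_def union_of_def by auto
  have "(countable intersection_of cozero_set X) (\<Inter>((\<lambda>U. ?S - U) ` \<U>))"
    unfolding intersection_of_def cozero_set_def using \<U>(1,2)
    by (intro exI[of _ "(\<lambda>U. ?S - U) ` \<U>"]) auto
  moreover have "A = ?S \<inter> \<Inter>((\<lambda>U. ?S - U) ` \<U>)" using \<U>(3) A by auto
  ultimately show "coz_delta X A"
    unfolding coz_delta_def relative_to_def by blast
qed

section \<open>Baire-one functions and indicators\<close>

text \<open>Frees the approximating functions from extensionality; they are restricted to
  \<open>topspace X\<close> once, here.\<close>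

lemma B1_funI:
  assumes "f \<in> extensional (topspace X)" "\<And>n. continuous_map X euclideanreal (g n)"
    "\<And>x. x \<in> topspace X \<Longrightarrow> (\<lambda>n. g n x) \<longlonglongrightarrow> f x"
  shows "f \<in> B1_fun X"
  unfolding B1_fun_def pointwise_seq_limits_def C_fun_def mem_Collect_eq
proof (intro conjI exI[of _ "\<lambda>n. restrict (g n) (topspace X)"] allI ballI assms(1))
  show "continuous_map X euclideanreal (restrict (g n) (topspace X))" for n
    by (rule continuous_map_eq[OF assms(2)]) simp
qed (use assms in auto)

lemma B1_funE:
  assumes "f \<in> B1_fun X"
  obtains g :: "nat \<Rightarrow> 'a \<Rightarrow> real" where "\<And>n. continuous_map X euclideanreal (g n)"
    "\<And>x. x \<in> topspace X \<Longrightarrow> (\<lambda>n. g n x) \<longlonglongrightarrow> f x"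
  using assms unfolding B1_fun_def by (elim pointwise_seq_limitsE) (auto simp: C_fun_def)

text \<open>The indicator of the zero-set of \<open>f\<close> is the limit of 1 / (1 + n
  \<bar>f\<bar>), and the indicator of a difference is the product of one indicator with the
  complement of the other.\<close>

lemma B1_fun_scaled_indicator_Diff:
  assumes "zero_set X A" "zero_set X B"
  shows "(\<lambda>x\<in>topspace X. c * indicator (A - B) x) \<in> B1_fun X"
proof -
  obtain f g where fg: "continuous_map X euclideanreal f" "A = {x \<in> topspace X. f x = 0}"
    "continuous_map X euclideanreal g" "B = {x \<in> topspace X. g x = 0}"
    using assms unfolding zero_set_def by blast
  have lim: "(\<lambda>n. 1 / (1 + real n * \<bar>t\<bar>)) \<longlonglongrightarrow> (if t = 0 then 1 else 0)" for t :: real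
  proof (cases "t = 0")
    case False
    then have "filterlim (\<lambda>n. 1 + real n * \<bar>t\<bar>) at_top sequentially"
      by (intro filterlim_tendsto_add_at_top[OF tendsto_const]
          filterlim_at_top_mult_tendsto_pos[OF tendsto_const _ filterlim_real_sequentially]) auto
    then show ?thesis
      using False by (simp add: tendsto_divide_0[OF tendsto_const] filterlim_at_top_imp_at_infinity)
  qed simp
  have pos: "1 + real n * \<bar>t\<bar> \<noteq> 0" for n and t :: real
    by (smt (verit) mult_nonneg_nonneg of_nat_0_le_iff abs_ge_zero)
  show ?thesis
  proof (rule B1_funI)
    show "continuous_map X euclideanreal
        (\<lambda>x. c * (1 / (1 + real n * \<bar>f x\<bar>) * (1 - 1 / (1 + real n * \<bar>g x\<bar>))))" for n
      by (intro continuous_intros fg pos)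
    fix x assume x: "x \<in> topspace X"
    have "(\<lambda>n. c * (1 / (1 + real n * \<bar>f x\<bar>) * (1 - 1 / (1 + real n * \<bar>g x\<bar>))))
        \<longlonglongrightarrow> c * ((if f x = 0 then 1 else 0) * (1 - (if g x = 0 then 1 else 0)))"
      by (intro tendsto_intros lim)
    also have "c * ((if f x = 0 then 1 else 0) * (1 - (if g x = 0 then 1 else 0)))
        = (\<lambda>x\<in>topspace X. c * indicator (A - B) x) x"
      using x by (simp add: fg(2,4))
    finally show "(\<lambda>n. c * (1 / (1 + real n * \<bar>f x\<bar>) * (1 - 1 / (1 + real n * \<bar>g x\<bar>))))
        \<longlonglongrightarrow> (\<lambda>x\<in>topspace X. c * indicator (A - B) x) x" .
  qed simp
qed

text \<open>A point lies outside \<open>A\<close> iff the approximants are eventually at most 1/2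
  there. This writes the complement as a countable union of countable intersections of
  zero-sets.\<close>

lemma coz_delta_indicator_B1:
  assumes A: "A \<subseteq> topspace X" and ind: "(\<lambda>x\<in>topspace X. indicator A x) \<in> B1_fun X"
  shows "coz_delta X A"
proof -
  let ?S = "topspace X"
  obtain g where g: "\<And>n. continuous_map X euclideanreal (g n)"
    and "\<And>x. x \<in> ?S \<Longrightarrow> (\<lambda>n. g n x) \<longlonglongrightarrow> (\<lambda>x\<in>?S. indicator A x) x"
    by (rule B1_funE[OF ind]) blast
  then have lim: "(\<lambda>n. g n x) \<longlonglongrightarrow> indicator A x" if "x \<in> ?S" for x
    using that by fastforce
  have "?S - A = (\<Union>N. \<Inter>n. {x \<in> ?S. g (N + n) x \<le> 1/2})" (is "_ = ?U")
  proof (intro equalityI subsetI)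
    fix x assume x: "x \<in> ?S - A"
    then have "\<forall>\<^sub>F n in sequentially. g n x < 1/2"
      using lim[of x] by (intro order_tendstoD(2)[of _ "indicator A x"]) auto
    then obtain N where "\<And>n. n \<ge> N \<Longrightarrow> g n x < 1/2"
      unfolding eventually_sequentially by blast
    then have "\<forall>n. g (N + n) x \<le> 1/2" by (simp add: less_imp_le)
    with x show "x \<in> ?U" by auto
  next
    fix x assume "x \<in> ?U"
    then obtain N where x: "x \<in> ?S" and N: "\<And>n. g (N + n) x \<le> 1/2" by auto
    have "(\<lambda>n. g (n + N) x) \<longlonglongrightarrow> indicator A x"
      by (rule LIMSEQ_ignore_initial_segment[OF lim[OF x]])
    then have "indicator A x \<le> (1/2 :: real)"
      by (rule LIMSEQ_le_const2) (use N in \<open>auto simp: add.commute\<close>)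
    with x show "x \<in> ?S - A" by (auto simp: indicator_def split: if_splits)
  qed
  moreover have "zer_sigma X ?U"
    by (intro zer_sigma_UN zer_sigma_zero_set zero_set_INT zero_set_le g)
  ultimately show ?thesis
    using coz_delta_iff_zer_sigma[OF A] by simp
qed

text \<open>Writing a \<open>Zer\<^sub>\<sigma>\<close>-set as a disjoint union of differences of zero-sets, at each point at most
  one of the indicators is nonzero, so they may be scaled by \<open>2 ^ Suc n\<close> and still form a null
  sequence.\<close>

lemma locally_complete_B1_imp_CZ_space:
  assumes lc: "locally_complete (B1_lcs X)"
  shows "CZ_space X"
  unfolding CZ_space_def
proof (intro allI impI)
  fix A assume "zer_sigma X A"
  then obtain Z :: "nat \<Rightarrow> 'a set" where Z: "\<And>n. zero_set X (Z n)" "A = (\<Union>n. Z n)"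
    by (rule zer_sigma_incseq) blast
  let ?S = "topspace X"
  have A: "A \<subseteq> ?S" using Z zero_set_subset by blast
  define D where "D = disjointed Z"
  define \<sigma> where "\<sigma> n = (\<lambda>x\<in>?S. 2 ^ Suc n * indicator (D n) x :: real)" for n
  \<comment> \<open>\<open>disjointed\<close> removes the union of finitely many earlier zero-sets,
    which is again a zero-set.\<close>
  have \<sigma>B1: "\<sigma> n \<in> B1_fun X" for n
    unfolding \<sigma>_def D_def disjointed_def
    by (intro B1_fun_scaled_indicator_Diff zero_set_finite_UN Z) simp
  have D: "A = (\<Union>n. D n)" by (simp add: D_def UN_disjointed_eq Z(2))
  have unique: "indicator (D n) x = (if n = m then 1 else 0 :: real)" if "x \<in> D m" for x m n
    using that disjoint_family_disjointed[of Z]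
    unfolding D_def[symmetric] disjoint_family_on_def by (auto simp: indicator_def)
  have F: "function_subspace ?S (B1_fun X)"
    unfolding B1_fun_def by (intro function_subspace_pointwise_seq_limits function_subspace_C_fun)
  have "(\<lambda>x\<in>?S. indicator A x) \<in> B1_fun X"
  proof (rule locally_complete_dyadic_series[OF F lc[unfolded B1_lcs_def] \<sigma>B1])
    fix x assume x: "x \<in> ?S"
    have "\<exists>m. \<forall>n>m. indicator (D n) x = (0::real)"
    proof (cases "x \<in> A")
      case True
      then obtain m where "x \<in> D m" unfolding D by blast
      from unique[OF this] show ?thesis by (intro exI[of _ m]) simp
    next
      case False
      then show ?thesis unfolding D by simp
    qed
    then obtain m where "\<forall>n>m. \<sigma> n x = 0" using x unfolding \<sigma>_def by auto
    then show "(\<lambda>n. \<sigma> n x) \<longlonglongrightarrow> 0"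
      by (intro tendsto_eventually eventually_sequentiallyI[of "Suc m"]) simp
    have "(\<lambda>n. indicator (D n) x) sums (indicator A x :: real)"
    proof (cases "x \<in> A")
      case True
      then obtain m where m: "x \<in> D m" unfolding D by blast
      show ?thesis using sums_single[of m "\<lambda>_. 1 :: real"] True by (simp add: unique[OF m])
    next
      case False
      then show ?thesis unfolding D by simp
    qed
    then show "(\<lambda>n. \<sigma> n x / 2 ^ Suc n) sums (\<lambda>x\<in>?S. indicator A x) x"
      using x by (simp add: \<sigma>_def)
  qed simp
  with A show "coz_delta X A" by (rule coz_delta_indicator_B1)
qed


section \<open>Measurable functions on CZ-spaces\<close>

text \<open>The Baire sigma-algebra, the smallest one making all continuous real functions
  measurable.\<close>

definition baire_algebra :: "'a topology \<Rightarrow> 'a measure"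
  where "baire_algebra X = sigma (topspace X) (Collect (zero_set X))"

lemma space_baire_algebra [simp]: "space (baire_algebra X) = topspace X"
  using zero_set_subset unfolding baire_algebra_def by (intro space_measure_of) auto

lemma sets_baire_algebra: "sets (baire_algebra X) = sigma_sets (topspace X) (Collect (zero_set X))"
  using zero_set_subset unfolding baire_algebra_def by (intro sets_measure_of) auto

lemma borel_measurable_C_fun: "C_fun X \<subseteq> borel_measurable (baire_algebra X)"
  by (auto simp: C_fun_def sets_baire_algebra intro!: borel_measurableI_le sigma_sets.Basic zero_set_le)

lemma borel_measurable_pointwise_seq_limits:
  assumes "F \<subseteq> borel_measurable M"
  shows "pointwise_seq_limits (space M) F \<subseteq> borel_measurable M"
proof
  fix f assume "f \<in> pointwise_seq_limits (space M) F"
  then obtain g where g: "\<And>n. g n \<in> F" "\<And>x. x \<in> space M \<Longrightarrow> (\<lambda>n. g n x) \<longlonglongrightarrow> f x"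
    by (rule pointwise_seq_limitsE) blast
  show "f \<in> borel_measurable M"
    by (rule borel_measurable_LIMSEQ_real[OF g(2) subsetD[OF assms g(1)]])
qed

text \<open>Induction over the generated sigma-algebra: only complements need the CZ condition,
  which makes a \<open>zer_sigma\<close> set \<open>coz_delta\<close> and hence its complement
  \<open>zer_sigma\<close>.\<close>

lemma CZ_space_zer_sigma:
  assumes "CZ_space X" "A \<in> sets (baire_algebra X)"
  shows "zer_sigma X A"
  using assms(2) unfolding sets_baire_algebra
proof (induction rule: sigma_sets.induct)
  case (Compl A)
  then have "A \<subseteq> topspace X"
    using sets.sets_into_space[of A "baire_algebra X"] by (simp add: sets_baire_algebra)
  moreover have "coz_delta X A" using assms(1) Compl.IH unfolding CZ_space_def by blast
  ultimately show ?case by (simp add: coz_delta_iff_zer_sigma)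
qed (auto intro: zer_sigma_zero_set zero_set_empty zer_sigma_UN)

section \<open>Continuous approximation of measurable functions\<close>

text \<open>Exhaust \<open>A\<close> and its complement by increasing zero-sets \<open>Z n\<close>
  and \<open>W n\<close>. These are disjoint, so a continuous quotient is 1 on the first and 0 on
  the second; at each point the values become constant.\<close>

lemma indicator_limit_of_continuous:
  assumes "zer_sigma X A" "zer_sigma X (topspace X - A)"
  obtains \<phi> :: "nat \<Rightarrow> 'a \<Rightarrow> real" where "\<And>n. continuous_map X euclideanreal (\<phi> n)"
    "\<And>n x. 0 \<le> \<phi> n x" "\<And>n x. \<phi> n x \<le> 1"
    "\<And>x. x \<in> topspace X \<Longrightarrow> (\<lambda>n. \<phi> n x) \<longlonglongrightarrow> indicator A x"
proof -
  let ?S = "topspace X"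
  obtain Z where Z: "\<And>n. zero_set X (Z n)" "incseq Z" "A = (\<Union>n. Z n)"
    using zer_sigma_incseq[OF assms(1)] by metis
  obtain W where W: "\<And>n. zero_set X (W n)" "incseq W" "?S - A = (\<Union>n. W n)"
    using zer_sigma_incseq[OF assms(2)] by metis
  obtain p where p: "\<And>n. continuous_map X euclideanreal (p n)" "\<And>n. Z n = {x \<in> ?S. p n x = 0}"
    using Z(1) unfolding zero_set_def by metis
  obtain q where q: "\<And>n. continuous_map X euclideanreal (q n)" "\<And>n. W n = {x \<in> ?S. q n x = 0}"
    using W(1) unfolding zero_set_def by metis
  define \<phi> where "\<phi> n x = \<bar>q n x\<bar> / (\<bar>p n x\<bar> + \<bar>q n x\<bar>)" for n x
  have nz: "\<bar>p n x\<bar> + \<bar>q n x\<bar> \<noteq> 0" if "x \<in> ?S" for n x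
  proof
    assume "\<bar>p n x\<bar> + \<bar>q n x\<bar> = 0"
    then have "x \<in> Z n" "x \<in> W n" using that by (auto simp: p q)
    then have "x \<in> A" "x \<in> ?S - A" using Z(3) W(3) by blast+
    then show False by blast
  qed
  show ?thesis
  proof
    show "continuous_map X euclideanreal (\<phi> n)" for n
      unfolding \<phi>_def by (intro continuous_intros p q nz)
    \<comment> \<open>Outside \<open>?S\<close> the denominator may vanish; the quotient is then 0
      and the bounds still hold.\<close>
    show "0 \<le> \<phi> n x" "\<phi> n x \<le> 1" for n x
      by (auto simp: \<phi>_def divide_le_eq_1)
    fix x assume x: "x \<in> ?S"
    have "\<exists>N. \<forall>n\<ge>N. \<phi> n x = indicator A x"
    proof (cases "x \<in> A")
      case True
      then obtain N where N: "x \<in> Z N" unfolding Z(3) by blast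
      have "\<phi> n x = indicator A x" if "n \<ge> N" for n
      proof -
        have "x \<in> Z n" using N incseqD[OF Z(2) that] by blast
        then show ?thesis using True nz[OF x, of n] by (simp add: \<phi>_def p(2))
      qed
      then show ?thesis by blast
    next
      case False
      then obtain N where N: "x \<in> W N" using x W(3) by blast
      have "\<phi> n x = indicator A x" if "n \<ge> N" for n
      proof -
        have "x \<in> W n" using N incseqD[OF W(2) that] by blast
        then show ?thesis using False by (simp add: \<phi>_def q(2))
      qed
      then show ?thesis by blast
    qed
    then show "(\<lambda>n. \<phi> n x) \<longlonglongrightarrow> indicator A x"
      by (intro tendsto_eventually) (simp add: eventually_sequentially)
  qed
qed

text \<open>The digits are parities of floors, and the first \<open>n\<close> of them add up to
  \<open>y\<close> rounded down to a multiple of 1/2^n.\<close>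

lemma binary_expansion_sums:
  fixes y :: real
  assumes "0 \<le> y" "y < 1"
  shows "(\<lambda>k. of_bool (odd \<lfloor>2 ^ Suc k * y\<rfloor>) / 2 ^ Suc k) sums y"
proof -
  have "(\<Sum>k<n. of_bool (odd \<lfloor>2 ^ Suc k * y\<rfloor>) / 2 ^ Suc k) = real_of_int \<lfloor>2 ^ n * y\<rfloor> / 2 ^ n" for n
  proof (induction n)
    case 0
    have "\<lfloor>y\<rfloor> = 0" using assms by (simp add: floor_eq_iff)
    then show ?case by simp
  next
    case (Suc n)
    \<comment> \<open>Halving the next floor drops its last binary digit, so the new digit is the
      remainder modulo 2.\<close>
    have "\<lfloor>2 ^ n * y\<rfloor> = \<lfloor>2 ^ Suc n * y / real_of_int 2\<rfloor>" by simp
    also have "\<dots> = \<lfloor>2 ^ Suc n * y\<rfloor> div 2" by (rule floor_divide_real_eq_div) simp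
    finally have "\<lfloor>2 ^ Suc n * y\<rfloor> = 2 * \<lfloor>2 ^ n * y\<rfloor> + of_bool (odd \<lfloor>2 ^ Suc n * y\<rfloor>)"
      by (auto elim: oddE)
    then have "real_of_int \<lfloor>2 ^ Suc n * y\<rfloor> = 2 * \<lfloor>2 ^ n * y\<rfloor> + of_bool (odd \<lfloor>2 ^ Suc n * y\<rfloor>)"
      by (metis of_int_add of_int_mult of_int_numeral of_int_of_bool)
    then show ?case
      by (simp only: sum.lessThan_Suc Suc.IH) (simp add: field_simps)
  qed
  moreover have "(\<lambda>n. real_of_int \<lfloor>2 ^ n * y\<rfloor> / 2 ^ n) \<longlonglongrightarrow> y"
  proof (rule tendsto_sandwich[of "\<lambda>n. y - (1/2) ^ n" _ _ "\<lambda>n. y"])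
    have "(\<lambda>n. y - (1/2) ^ n) \<longlonglongrightarrow> y - 0"
      by (intro tendsto_diff tendsto_const LIMSEQ_power_zero) simp
    then show "(\<lambda>n. y - (1/2) ^ n) \<longlonglongrightarrow> y" by simp
    have "y - (1/2) ^ n \<le> real_of_int \<lfloor>2 ^ n * y\<rfloor> / 2 ^ n" for n
    proof -
      have "2 ^ n * y - 1 \<le> real_of_int \<lfloor>2 ^ n * y\<rfloor>" by linarith
      then have "(2 ^ n * y - 1) / 2 ^ n \<le> real_of_int \<lfloor>2 ^ n * y\<rfloor> / 2 ^ n"
        by (rule divide_right_mono) simp
      then show ?thesis by (simp add: field_simps power_one_over)
    qed
    then show "\<forall>\<^sub>F n in sequentially. y - (1/2) ^ n \<le> real_of_int \<lfloor>2 ^ n * y\<rfloor> / 2 ^ n"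
      by simp
    have "real_of_int \<lfloor>2 ^ n * y\<rfloor> / 2 ^ n \<le> y" for n
      using of_int_floor_le[of "2 ^ n * y"] by (simp add: field_simps)
    then show "\<forall>\<^sub>F n in sequentially. real_of_int \<lfloor>2 ^ n * y\<rfloor> / 2 ^ n \<le> y"
      by simp
  qed simp
  ultimately show ?thesis by (simp add: sums_def)
qed

text \<open>The binary digits of the function are indicators of measurable sets.\<close>

lemma CZ_space_limit_of_continuous_unit_interval:
  fixes f :: "'a \<Rightarrow> real"
  assumes CZ: "CZ_space X" and f [measurable]: "f \<in> borel_measurable (baire_algebra X)"
    and f01: "\<And>x. x \<in> topspace X \<Longrightarrow> 0 \<le> f x" "\<And>x. x \<in> topspace X \<Longrightarrow> f x < 1"
  obtains g :: "nat \<Rightarrow> 'a \<Rightarrow> real" where "\<And>n. continuous_map X euclideanreal (g n)"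
    "\<And>x. x \<in> topspace X \<Longrightarrow> (\<lambda>n. g n x) \<longlonglongrightarrow> f x"
proof -
  let ?S = "topspace X"
  define B where "B k = {x \<in> ?S. odd \<lfloor>2 ^ Suc k * f x\<rfloor>}" for k
  have B: "B k \<in> sets (baire_algebra X)" for k
  proof -
    have "{x \<in> space (baire_algebra X). odd \<lfloor>2 ^ Suc k * f x\<rfloor>} \<in> sets (baire_algebra X)"
      by measurable
    then show ?thesis by (simp add: B_def)
  qed
  have "\<exists>\<phi>. (\<forall>n. continuous_map X euclideanreal (\<phi> n)) \<and> (\<forall>n x. 0 \<le> \<phi> n x \<and> \<phi> n x \<le> 1) \<and>
      (\<forall>x\<in>?S. (\<lambda>n. \<phi> n x) \<longlonglongrightarrow> (indicator (B k) x :: real))" for k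
  proof -
    have "?S - B k \<in> sets (baire_algebra X)"
      using sets.compl_sets[OF B[of k]] by simp
    then obtain \<phi> :: "nat \<Rightarrow> 'a \<Rightarrow> real" where "\<And>n. continuous_map X euclideanreal (\<phi> n)"
      "\<And>n x. 0 \<le> \<phi> n x" "\<And>n x. \<phi> n x \<le> 1"
      "\<And>x. x \<in> ?S \<Longrightarrow> (\<lambda>n. \<phi> n x) \<longlonglongrightarrow> indicator (B k) x"
      using indicator_limit_of_continuous CZ_space_zer_sigma[OF CZ] B by metis
    then show ?thesis by blast
  qed
  then obtain \<phi> :: "nat \<Rightarrow> nat \<Rightarrow> 'a \<Rightarrow> real"
    where \<phi>: "\<And>k n. continuous_map X euclideanreal (\<phi> k n)"
      "\<And>k n x. 0 \<le> \<phi> k n x" "\<And>k n x. \<phi> k n x \<le> 1"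
      "\<And>k x. x \<in> ?S \<Longrightarrow> (\<lambda>n. \<phi> k n x) \<longlonglongrightarrow> indicator (B k) x"
    by metis
  show ?thesis
  \<comment> \<open>A diagonal choice: the first \<open>n\<close> digits, each replaced by its
    \<open>n\<close>-th approximant.\<close>
  proof (rule that[of "\<lambda>n x. \<Sum>k<n. \<phi> k n x / 2 ^ Suc k"])
    show "continuous_map X euclideanreal (\<lambda>x. \<Sum>k<n. \<phi> k n x / 2 ^ Suc k)" for n
      by (intro continuous_intros \<phi>) auto
    fix x assume x: "x \<in> ?S"
    \<comment> \<open>Padding with zeros turns the finite sums into full series, so that Tannery's
      theorem, dominated convergence for series, interchanges limit and sum.\<close>
    define a where "a k n = (if k < n then \<phi> k n x / 2 ^ Suc k else 0)" for k n
    have "(\<lambda>n. \<Sum>k. a k n) \<longlonglongrightarrow> (\<Sum>k. indicator (B k) x / 2 ^ Suc k)"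
    proof (rule tannerys_theorem[THEN conjunct2, THEN conjunct2, of a _ sequentially "\<lambda>k. (1/2) ^ Suc k"])
      show "(\<lambda>n. a k n) \<longlonglongrightarrow> indicator (B k) x / 2 ^ Suc k" for k
      proof (rule Lim_transform_eventually)
        show "(\<lambda>n. \<phi> k n x / 2 ^ Suc k) \<longlonglongrightarrow> indicator (B k) x / 2 ^ Suc k"
          by (intro tendsto_intros \<phi>(4)[OF x]) simp
        show "\<forall>\<^sub>F n in sequentially. \<phi> k n x / 2 ^ Suc k = a k n"
          using eventually_gt_at_top[of k] by eventually_elim (simp add: a_def)
      qed
      have "norm (a k n) \<le> (1/2) ^ Suc k" for k n
        using \<phi>(2,3)[of k n x] by (auto simp: a_def power_one_over field_simps)
      then show "\<forall>\<^sub>F (k, n) in at_top \<times>\<^sub>F sequentially. norm (a k n) \<le> (1/2) ^ Suc k"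
        by (intro always_eventually) auto
      show "summable (\<lambda>k. (1/2 :: real) ^ Suc k)"
        by (subst summable_Suc_iff) (simp add: summable_geometric)
    qed simp
    also have "(\<lambda>n. \<Sum>k. a k n) = (\<lambda>n. \<Sum>k<n. \<phi> k n x / 2 ^ Suc k)"
      by (rule ext, subst suminf_finite[of "{..<_}"]) (auto simp: a_def)
    also have "(\<Sum>k. indicator (B k) x / 2 ^ Suc k) = f x"
    proof -
      have "indicator (B k) x = (of_bool (odd \<lfloor>2 ^ Suc k * f x\<rfloor>) :: real)" for k
        using x by (simp add: B_def indicator_def)
      then show ?thesis
        using binary_expansion_sums[OF f01[OF x]] by (simp only: sums_unique[symmetric])
    qed
    finally show "(\<lambda>n. \<Sum>k<n. \<phi> k n x / 2 ^ Suc k) \<longlonglongrightarrow> f x" .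
  qed
qed

text \<open>Compress the line into the unit interval by t / (1 + \<bar>t\<bar>), shifted and halved,
  approximate there, and undo the compression by y / (1 - \<bar>y\<bar>).\<close>

lemma CZ_space_borel_measurable_imp_B1:
  assumes CZ: "CZ_space X" and f [measurable]: "f \<in> borel_measurable (baire_algebra X)"
    and ext: "f \<in> extensional (topspace X)"
  shows "f \<in> B1_fun X"
proof -
  let ?S = "topspace X"
  define h where "h x = (f x / (1 + \<bar>f x\<bar>) + 1) / 2" for x
  have [measurable]: "h \<in> borel_measurable (baire_algebra X)" unfolding h_def by measurable
  have h01: "0 \<le> h x" "h x < 1" for x
  proof -
    have "-1 \<le> f x / (1 + \<bar>f x\<bar>)" "f x / (1 + \<bar>f x\<bar>) < 1" by (auto simp: field_simps)
    then show "0 \<le> h x" "h x < 1" by (auto simp: h_def)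
  qed
  obtain g where g: "\<And>n. continuous_map X euclideanreal (g n)"
      "\<And>x. x \<in> ?S \<Longrightarrow> (\<lambda>n. g n x) \<longlonglongrightarrow> h x"
    by (rule CZ_space_limit_of_continuous_unit_interval[OF CZ \<open>h \<in> _\<close> h01]) blast
  \<comment> \<open>The value \<open>2 * g n x - 1\<close> is not known to lie strictly between -1
    and 1. The lower bound \<open>1 / real (Suc n)\<close> keeps the denominator positive and
    disappears in the limit.\<close>
  define u where "u n x = (2 * g n x - 1) / max (1 / real (Suc n)) (1 - \<bar>2 * g n x - 1\<bar>)" for n x
  show ?thesis
  proof (rule B1_funI[OF ext, of u])
    have "max (1 / real (Suc n)) t \<noteq> 0" for n t
      by (simp add: max_def not_le) (smt (verit) divide_pos_pos of_nat_0_le_iff)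
    then show "continuous_map X euclideanreal (u n)" for n
      unfolding u_def by (intro continuous_intros g) auto
    fix x assume x: "x \<in> ?S"
    define y where "y = f x / (1 + \<bar>f x\<bar>)"
    have y: "2 * h x - 1 = y" unfolding h_def y_def[symmetric] by (simp add: field_simps)
    have "1 - \<bar>y\<bar> = 1 / (1 + \<bar>f x\<bar>)" by (simp add: y_def field_simps)
    then have y1: "1 - \<bar>y\<bar> > 0" and yf: "y / (1 - \<bar>y\<bar>) = f x"
      by (simp_all add: y_def)
    have "(\<lambda>n. u n x) \<longlonglongrightarrow> (2 * h x - 1) / max 0 (1 - \<bar>2 * h x - 1\<bar>)"
      unfolding u_def using y1 y
      by (intro tendsto_intros g(2)[OF x] LIMSEQ_Suc[OF lim_1_over_n]) auto
    then show "(\<lambda>n. u n x) \<longlonglongrightarrow> f x"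
      using y1 yf by (simp add: y)
  qed
qed

text \<open>Measurability survives both limits, so a function in \<open>B2_fun X\<close> is
  measurable and the CZ condition returns it to \<open>B1_fun X\<close>.\<close>

lemma CZ_space_imp_B1_eq_B2:
  assumes "CZ_space X"
  shows "B1_fun X = B2_fun X"
proof
  show "B1_fun X \<subseteq> B2_fun X"
    unfolding B2_fun_def by (rule subset_pointwise_seq_limits) (auto simp: B1_fun_def pointwise_seq_limits_def)
  have "B2_fun X \<subseteq> borel_measurable (baire_algebra X)"
    using borel_measurable_pointwise_seq_limits[OF borel_measurable_pointwise_seq_limits[OF borel_measurable_C_fun[of X]]]
    by (simp add: B1_fun_def B2_fun_def)
  then show "B2_fun X \<subseteq> B1_fun X"
    using CZ_space_borel_measurable_imp_B1[OF assms]
    by (auto simp: B2_fun_def pointwise_seq_limits_def)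
qed

theorem theorem3p4:
  fixes X :: "'a topology"
  assumes "completely_regular_space X" and "Hausdorff_space X"
  shows "(sequentially_complete (B1_lcs X) \<longleftrightarrow> locally_complete (B1_lcs X)) \<and>
         (locally_complete (B1_lcs X) \<longleftrightarrow> B1_fun X = B2_fun X) \<and>
         (B1_fun X = B2_fun X \<longleftrightarrow> CZ_space X)"
proof -
  have F: "function_subspace (topspace X) (B1_fun X)"
    unfolding B1_fun_def by (intro function_subspace_pointwise_seq_limits function_subspace_C_fun)
  have "sequentially_complete (B1_lcs X) \<longleftrightarrow> B1_fun X = B2_fun X"
    unfolding B1_lcs_def B2_fun_def by (rule sequentially_complete_pointwise_lcs[OF F])
  moreover have "locally_complete (B1_lcs X)" if "B1_fun X = B2_fun X"
    unfolding B1_lcs_def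
    by (rule locally_complete_pointwise_lcs[OF F]) (use that in \<open>simp add: B2_fun_def\<close>)
  \<comment> \<open>The remaining implications form a cycle: equality of the classes gives local
    completeness, which gives the CZ condition, which gives equality.\<close>
  ultimately show ?thesis
    using locally_complete_B1_imp_CZ_space CZ_space_imp_B1_eq_B2 by blast
qed

end
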